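(* For every $\varepsilon\in(0,1)$ and $q\in\mathbb{N}$, there exists an integer $t_3=t_3(q,\varepsilon)$ such that for every integer $t\ge t_3$ and all $k_1,k_2,\dots,k_q\in\mathbb{N}$ satisfying $\sum_{j=1}^q k_j\le (2-\varepsilon)t$, there exists a $K_t$-minor-free graph $G$ that is not $\{k_1,k_2,\dots,k_q\}$-choosable.
   Context: $\mathbb{N}$ denotes the positive integers. All graphs are finite and simple. A graph is $K_t$-minor-free if $K_t$ cannot be obtained from a subgraph of it by contracting edges. A list assignment $L$ of a graph $G$ assigns to each vertex $v$ a set $L(v)$ of colours; an $L$-colouring is a proper colouring $f$ with $f(v)\in L(v)$ for all $v$. For a multiset $\lambda=\{k_1,\dots,k_q\}$ of positive integers, a $\lambda$-list assignment of $G$ is a list assignment $L$ such that the colour set $\bigcup_{v\in V(G)}L(v)$ can be partitioned into $q$ sets $C_1,\dots,C_q$ with $|L(v)\cap C_i|\ge k_i$ for every $i$ and every vertex $v$. $G$ is $\lambda$-choosable if $G$ is $L$-colourable for every $\lambda$-list assignment $L$. *)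

theory Defs
  imports Complex_Main
begin

type_synonym graph = "nat set \<times> (nat \<Rightarrow> nat \<Rightarrow> bool)"

definition verts :: "graph \<Rightarrow> nat set" where "verts G = fst G"
definition adj :: "graph \<Rightarrow> nat \<Rightarrow> nat \<Rightarrow> bool" where "adj G = snd G"

definition simple_graph :: "graph \<Rightarrow> bool" where
  "simple_graph G \<longleftrightarrow> finite (verts G) \<and>
     (\<forall>x y. adj G x y \<longrightarrow> x \<in> verts G \<and> y \<in> verts G \<and> x \<noteq> y) \<and>
     (\<forall>x y. adj G x y \<longrightarrow> adj G y x)"

definition subgraph :: "graph \<Rightarrow> graph \<Rightarrow> bool" where
  "subgraph H G \<longleftrightarrow> simple_graph H \<and> verts H \<subseteq> verts G \<and>
     (\<forall>x y. adj H x y \<longrightarrow> adj G x y)"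

definition contract :: "graph \<Rightarrow> nat \<Rightarrow> nat \<Rightarrow> graph" where
  "contract G u v = (verts G - {v},
     (\<lambda>x y. x \<in> verts G - {v} \<and> y \<in> verts G - {v} \<and> x \<noteq> y \<and>
        (adj G x y \<or> (x = u \<and> adj G v y) \<or> (y = u \<and> adj G v x))))"

definition contract_step :: "graph \<Rightarrow> graph \<Rightarrow> bool" where
  "contract_step G H \<longleftrightarrow> (\<exists>u v. adj G u v \<and> H = contract G u v)"

definition is_complete_graph :: "nat \<Rightarrow> graph \<Rightarrow> bool" where
  "is_complete_graph t H \<longleftrightarrow> card (verts H) = t \<and> finite (verts H) \<and>
     (\<forall>x\<in>verts H. \<forall>y\<in>verts H. x \<noteq> y \<longrightarrow> adj H x y)"

definition has_K_minor :: "nat \<Rightarrow> graph \<Rightarrow> bool" where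
  "has_K_minor t G \<longleftrightarrow>
     (\<exists>S H. subgraph S G \<and> contract_step\<^sup>*\<^sup>* S H \<and> is_complete_graph t H)"

text \<open>lambda-list assignment, lambda = multiset of entries of ks (q = length ks).\<close>
definition lambda_list_assignment :: "nat list \<Rightarrow> graph \<Rightarrow> (nat \<Rightarrow> nat set) \<Rightarrow> bool" where
  "lambda_list_assignment ks G L \<longleftrightarrow>
     (\<forall>v\<in>verts G. finite (L v)) \<and>
     (\<exists>C :: nat \<Rightarrow> nat set.
        (\<forall>i<length ks. \<forall>j<length ks. i \<noteq> j \<longrightarrow> C i \<inter> C j = {}) \<and>
        (\<Union>i<length ks. C i) = (\<Union>v\<in>verts G. L v) \<and>
        (\<forall>v\<in>verts G. \<forall>i<length ks. card (L v \<inter> C i) \<ge> ks ! i))"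

definition L_colourable :: "graph \<Rightarrow> (nat \<Rightarrow> nat set) \<Rightarrow> bool" where
  "L_colourable G L \<longleftrightarrow> (\<exists>f :: nat \<Rightarrow> nat. (\<forall>v\<in>verts G. f v \<in> L v) \<and>
     (\<forall>u v. adj G u v \<longrightarrow> f u \<noteq> f v))"

definition lambda_choosable :: "nat list \<Rightarrow> graph \<Rightarrow> bool" where
  "lambda_choosable ks G \<longleftrightarrow>
     (\<forall>L. lambda_list_assignment ks G L \<longrightarrow> L_colourable G L)"

end

theory Submission
  imports Defs "HOL-Library.Disjoint_Sets" "HOL-Library.FuncSet" "HOL-Library.Nat_Bijection" "HOL-Real_Asymp.Real_Asymp"
begin

text \<open>
  Let A and B be cliques on n vertices, with a sparse random-like bipartite graph F of non-edges
  between them. If F contains a complete bipartite graph between some members of any two large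
  families of disjoint small subsets of A and of B, then in a complete minor few small branch sets
  avoid A, or few avoid B; as at most n branch sets meet either clique, the minor has order at most
  (1 + o(1)) n. Paste copies of B to one common A, one for each colouring c of A from a palette of
  fewer than 2 n colours. Since pasting happens along a clique, this creates no larger complete
  minor. In the copy for c, remove from the list of b the colours under c of its few
  F-neighbours. Then a colouring extending c would use 2 n distinct colours. The palette is split
  into q parts with enough slack that the removed colours do not spoil any of the q list sizes.
\<close>

section \<open>Branch sets of complete minors\<close>

text \<open>A form of connectedness without walks: every predicate preserved along the edges inside
  \<open>X\<close> is constant on \<open>X\<close>. The empty set qualifies, so nonemptiness of
  branch sets is demanded separately.\<close>

definition connected_set :: "graph \<Rightarrow> nat set \<Rightarrow> bool" where
  "connected_set G X \<longleftrightarrow> (\<forall>P. (\<forall>x\<in>X. \<forall>y\<in>X. adj G x y \<longrightarrow> P x \<longrightarrow> P y) \<longrightarrow>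
     (\<forall>x\<in>X. \<forall>y\<in>X. P x \<longrightarrow> P y))"

lemma connected_setD:
  assumes "connected_set G X" "\<And>x y. x \<in> X \<Longrightarrow> y \<in> X \<Longrightarrow> adj G x y \<Longrightarrow> P x \<Longrightarrow> P y"
    and "x \<in> X" "y \<in> X" "P x"
  shows "P y"
  using assms unfolding connected_set_def by blast

lemma connected_set_singleton: "connected_set G {x}"
  unfolding connected_set_def by blast

lemma connected_set_mono:
  assumes "connected_set S X" "\<And>x y. adj S x y \<Longrightarrow> adj G x y"
  shows "connected_set G X"
  using assms unfolding connected_set_def by blast

text \<open>A predicate that is constant on \<open>X\<close> and on \<open>Y\<close> is transported
  between them by the edge at \<open>x0\<close> and \<open>y0\<close>, which is assumed in both
  orientations because symmetry of \<open>G\<close> is not assumed here.\<close>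

lemma connected_set_Un:
  assumes X: "connected_set G X" and Y: "connected_set G Y"
    and "x0 \<in> X" "y0 \<in> Y" "adj G x0 y0" "adj G y0 x0"
  shows "connected_set G (X \<union> Y)"
  unfolding connected_set_def
proof (intro allI impI ballI)
  fix P x y
  assume step: "\<forall>x\<in>X \<union> Y. \<forall>y\<in>X \<union> Y. adj G x y \<longrightarrow> P x \<longrightarrow> P y"
    and x: "x \<in> X \<union> Y" and y: "y \<in> X \<union> Y" and "P x"
  have inX: "P b" if "a \<in> X" "b \<in> X" "P a" for a b
    using connected_setD[OF X _ that(1,2), of P] step that(3) by blast
  have inY: "P b" if "a \<in> Y" "b \<in> Y" "P a" for a b
    using connected_setD[OF Y _ that(1,2), of P] step that(3) by blast
  have "P x0 \<longleftrightarrow> P y0"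
    using step assms(3-6) by blast
  then show "P y"
    using x y \<open>P x\<close> inX inY assms(3,4) by blast
qed

text \<open>\<open>X i\<close> is the branch set of the vertex \<open>i\<close> of \<open>H\<close>,
  that is, the set of vertices of \<open>G\<close> contracted into \<open>i\<close>. Only edges of
  \<open>H\<close> have to be realised in \<open>G\<close>, not conversely.\<close>

definition minor_model :: "graph \<Rightarrow> graph \<Rightarrow> (nat \<Rightarrow> nat set) \<Rightarrow> bool" where
  "minor_model G H X \<longleftrightarrow>
     (\<forall>i\<in>verts H. X i \<noteq> {} \<and> X i \<subseteq> verts G \<and> connected_set G (X i)) \<and>
     (\<forall>i\<in>verts H. \<forall>j\<in>verts H. i \<noteq> j \<longrightarrow> X i \<inter> X j = {}) \<and>
     (\<forall>i j. adj H i j \<longrightarrow> (\<exists>x\<in>X i. \<exists>y\<in>X j. adj G x y))"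

lemma verts_contract: "verts (contract G u v) = verts G - {v}"
  by (simp add: contract_def verts_def)

lemma adj_contract:
  "adj (contract G u v) x y \<longleftrightarrow> x \<in> verts G - {v} \<and> y \<in> verts G - {v} \<and> x \<noteq> y \<and>
     (adj G x y \<or> (x = u \<and> adj G v y) \<or> (y = u \<and> adj G v x))"
  by (simp add: contract_def adj_def)

lemma simple_graph_contract:
  assumes "simple_graph G"
  shows "simple_graph (contract G u v)"
  using assms unfolding simple_graph_def verts_contract adj_contract by blast

text \<open>Contracting \<open>v\<close> into \<open>u\<close> merges their branch sets, which stay
  connected because the edge from \<open>u\<close> to \<open>v\<close> is realised in
  \<open>G\<close>. The value at \<open>v\<close> may remain, as \<open>v\<close> is no longer a
  vertex.\<close>

lemma minor_model_contract:
  assumes G: "simple_graph G" and H: "simple_graph H" and X: "minor_model G H X"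
    and uv: "adj H u v"
  shows "minor_model G (contract H u v) (X(u := X u \<union> X v))"
proof -
  have symG: "adj G y x" if "adj G x y" for x y
    using G that unfolding simple_graph_def by blast
  have u: "u \<in> verts H" and v: "v \<in> verts H" and "u \<noteq> v"
    using H uv unfolding simple_graph_def by blast+
  have edge: "\<exists>x\<in>X i. \<exists>y\<in>X j. adj G x y" if "adj H i j" for i j
    using X that unfolding minor_model_def by blast
  have branch: "X i \<noteq> {} \<and> X i \<subseteq> verts G \<and> connected_set G (X i)" if "i \<in> verts H" for i
    using X that unfolding minor_model_def by blast
  have disj: "X i \<inter> X j = {}" if "i \<in> verts H" "j \<in> verts H" "i \<noteq> j" for i j
    using X that unfolding minor_model_def by blast
  have "connected_set G (X u \<union> X v)"
    using edge[OF uv] branch[OF u] branch[OF v] symG connected_set_Un[of G "X u" "X v"] by blast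
  then have 1: "\<forall>i\<in>verts H - {v}. (X(u := X u \<union> X v)) i \<noteq> {} \<and>
      (X(u := X u \<union> X v)) i \<subseteq> verts G \<and> connected_set G ((X(u := X u \<union> X v)) i)"
    using branch u v by auto
  have 2: "\<forall>i\<in>verts H - {v}. \<forall>j\<in>verts H - {v}. i \<noteq> j \<longrightarrow>
      (X(u := X u \<union> X v)) i \<inter> (X(u := X u \<union> X v)) j = {}"
    using disj u v by (auto simp: Int_Un_distrib Int_Un_distrib2)
  have 3: "\<exists>x\<in>(X(u := X u \<union> X v)) i. \<exists>y\<in>(X(u := X u \<union> X v)) j. adj G x y"
    if ij: "adj (contract H u v) i j" for i j
  proof -
    have sub: "X l \<subseteq> (X(u := X u \<union> X v)) l" "X v \<subseteq> (X(u := X u \<union> X v)) u" for l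
      by auto
    consider "adj H i j" | "i = u" "adj H v j" | "j = u" "adj H v i"
      using ij unfolding adj_contract by blast
    then show ?thesis
    proof cases
      case 1
      then show ?thesis using edge[OF 1] sub(1) by blast
    next
      case 2
      then show ?thesis using edge[OF 2(2)] sub(1)[of j] sub(2) by blast
    next
      case 3
      then show ?thesis using edge[OF 3(2)] sub(1)[of i] sub(2) symG by blast
    qed
  qed
  show ?thesis
    unfolding minor_model_def verts_contract using 1 2 3 by blast
qed

text \<open>Before any contraction the branch sets are singletons, and each step preserves the
  existence of a model.\<close>

lemma minor_model_contract_steps:
  assumes "contract_step\<^sup>*\<^sup>* S H" "simple_graph S"
  shows "simple_graph H \<and> (\<exists>X. minor_model S H X)"
  using assms(1)
proof (induction rule: rtranclp_induct)
  case base
  have "minor_model S S (\<lambda>i. {i})"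
    unfolding minor_model_def by (auto simp: connected_set_singleton)
  then show ?case using assms(2) by blast
next
  case (step H H')
  then show ?case
    unfolding contract_step_def
    using assms(2) simple_graph_contract minor_model_contract by blast
qed

text \<open>This is the form in which minors are used from here on. Passing from the subgraph
  \<open>S\<close> to \<open>G\<close> only adds vertices and edges, so connectedness and adjacency
  of the branch sets survive.\<close>

lemma has_K_minor_branch_sets:
  assumes "has_K_minor t G"
  obtains I :: "nat set" and X where "finite I" "card I = t"
    "\<And>i. i \<in> I \<Longrightarrow> X i \<noteq> {} \<and> X i \<subseteq> verts G \<and> connected_set G (X i)"
    "\<And>i j. i \<in> I \<Longrightarrow> j \<in> I \<Longrightarrow> i \<noteq> j \<Longrightarrow> X i \<inter> X j = {}"
    "\<And>i j. i \<in> I \<Longrightarrow> j \<in> I \<Longrightarrow> i \<noteq> j \<Longrightarrow> \<exists>x\<in>X i. \<exists>y\<in>X j. adj G x y"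
proof -
  obtain S H where S: "subgraph S G" and H: "contract_step\<^sup>*\<^sup>* S H" "is_complete_graph t H"
    using assms unfolding has_K_minor_def by blast
  obtain X where X: "minor_model S H X"
    using minor_model_contract_steps[OF H(1)] S unfolding subgraph_def by blast
  have adj: "adj G x y" if "adj S x y" for x y
    using S that unfolding subgraph_def by blast
  have vs: "verts S \<subseteq> verts G"
    using S unfolding subgraph_def by blast
  show thesis
  proof (rule that[of "verts H" X])
    show "finite (verts H)" "card (verts H) = t"
      using H(2) unfolding is_complete_graph_def by auto
    show "X i \<noteq> {} \<and> X i \<subseteq> verts G \<and> connected_set G (X i)" if "i \<in> verts H" for i
      using X vs that adj connected_set_mono unfolding minor_model_def by blast
    show "X i \<inter> X j = {}" if "i \<in> verts H" "j \<in> verts H" "i \<noteq> j" for i j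
      using X that unfolding minor_model_def by blast
    show "\<exists>x\<in>X i. \<exists>y\<in>X j. adj G x y" if "i \<in> verts H" "j \<in> verts H" "i \<noteq> j" for i j
    proof -
      have "adj H i j" using H(2) that unfolding is_complete_graph_def by blast
      then show ?thesis using X adj unfolding minor_model_def by blast
    qed
  qed
qed

section \<open>Cliques pasted along a common clique\<close>

text \<open>Vertices are natural numbers, so a pair of a layer index and a position inside that
  layer is coded by \<open>prod_encode\<close>.\<close>

definition layer :: "nat \<Rightarrow> nat" where "layer v = fst (prod_decode v)"
definition pos :: "nat \<Rightarrow> nat" where "pos v = snd (prod_decode v)"

lemma layer_pos_encode [simp]: "layer (prod_encode (r, b)) = r" "pos (prod_encode (r, b)) = b"
  by (simp_all add: layer_def pos_def)

lemma layer_pos_eqI: "layer x = layer y \<Longrightarrow> pos x = pos y \<Longrightarrow> x = y"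
  unfolding layer_def pos_def by (metis prod.collapse prod_decode_inverse)

text \<open>Layer 0 is the common clique A, the layers 1, ..., M are the cliques pasted to it, and
  F a b says that a in A and the b-th vertex of such a clique are not adjacent.\<close>

definition pasted_graph :: "nat \<Rightarrow> nat \<Rightarrow> (nat \<Rightarrow> nat \<Rightarrow> bool) \<Rightarrow> graph" where
  "pasted_graph M n F = ({v. layer v \<le> M \<and> pos v < n},
     (\<lambda>x y. x \<noteq> y \<and> layer x \<le> M \<and> pos x < n \<and> layer y \<le> M \<and> pos y < n \<and>
        (layer x = layer y \<or> layer x = 0 \<and> \<not> F (pos x) (pos y) \<or>
         layer y = 0 \<and> \<not> F (pos y) (pos x))))"

lemma verts_pasted_graph: "verts (pasted_graph M n F) = {v. layer v \<le> M \<and> pos v < n}"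
  by (simp add: pasted_graph_def verts_def)

lemma adj_pasted_graph:
  "adj (pasted_graph M n F) x y \<longleftrightarrow>
     x \<noteq> y \<and> layer x \<le> M \<and> pos x < n \<and> layer y \<le> M \<and> pos y < n \<and>
        (layer x = layer y \<or> layer x = 0 \<and> \<not> F (pos x) (pos y) \<or>
         layer y = 0 \<and> \<not> F (pos y) (pos x))"
  by (simp add: pasted_graph_def adj_def)

lemma simple_graph_pasted_graph: "simple_graph (pasted_graph M n F)"
proof -
  have "{v. layer v \<le> M \<and> pos v < n} \<subseteq> prod_encode ` ({..M} \<times> {..<n})"
  proof
    fix v assume "v \<in> {v. layer v \<le> M \<and> pos v < n}"
    then show "v \<in> prod_encode ` ({..M} \<times> {..<n})"
      by (intro image_eqI[of _ _ "(layer v, pos v)"]) (auto simp: layer_def pos_def mem_Times_iff)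
  qed
  then have "finite {v. layer v \<le> M \<and> pos v < n}"
    by (rule finite_subset) auto
  then show ?thesis
    unfolding simple_graph_def verts_pasted_graph adj_pasted_graph by auto
qed

text \<open>Two branch sets avoiding layer 0 lie in the same layer, being connected and adjacent, so
  all branch sets survive the restriction to layer 0 and that layer.\<close>

lemma pasted_graph_minor:
  assumes "has_K_minor t (pasted_graph M n F)"
  obtains I :: "nat set" and P Q where "finite I" "card I = t"
    "\<And>i. i \<in> I \<Longrightarrow> P i \<subseteq> {..<n}" "\<And>i. i \<in> I \<Longrightarrow> Q i \<subseteq> {..<n}"
    "\<And>i. i \<in> I \<Longrightarrow> P i \<noteq> {} \<or> Q i \<noteq> {}"
    "disjoint_family_on P I" "disjoint_family_on Q I"
    "\<And>i j. i \<in> I \<Longrightarrow> j \<in> I \<Longrightarrow> Q i = {} \<Longrightarrow> P j = {} \<Longrightarrow> \<exists>a\<in>P i. \<exists>b\<in>Q j. \<not> F a b"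
proof (rule has_K_minor_branch_sets[OF assms])
  let ?G = "pasted_graph M n F"
  fix I :: "nat set" and X
  assume I: "finite I" "card I = t"
    and X: "\<And>i. i \<in> I \<Longrightarrow> X i \<noteq> {} \<and> X i \<subseteq> verts ?G \<and> connected_set ?G (X i)"
    and disj: "\<And>i j. i \<in> I \<Longrightarrow> j \<in> I \<Longrightarrow> i \<noteq> j \<Longrightarrow> X i \<inter> X j = {}"
    and edge: "\<And>i j. i \<in> I \<Longrightarrow> j \<in> I \<Longrightarrow> i \<noteq> j \<Longrightarrow> \<exists>x\<in>X i. \<exists>y\<in>X j. adj ?G x y"
  define R where "R r i = pos ` {x \<in> X i. layer x = r}" for r i
  have R_sub: "R r i \<subseteq> {..<n}" if "i \<in> I" for r i
    using X[OF that] unfolding R_def verts_pasted_graph by auto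
  have R_disj: "disjoint_family_on (R r) I" for r
    unfolding disjoint_family_on_def R_def using disj layer_pos_eqI by fastforce
  \<comment> \<open>An edge between different layers has an end in layer 0. Inside a branch set
    avoiding layer 0 the layer is therefore preserved along edges, and connectedness
    applies.\<close>
  have one_layer: "layer y = layer x"
    if "i \<in> I" "R 0 i = {}" "x \<in> X i" "y \<in> X i" for i x y
  proof (rule connected_setD[of ?G "X i" "\<lambda>y. layer y = layer x" x y])
    fix u v assume "u \<in> X i" "v \<in> X i" "adj ?G u v" "layer u = layer x"
    then show "layer v = layer x"
      using that(2) unfolding adj_pasted_graph R_def by auto
  qed (use X that in auto)
  have same_layer: "layer y = layer x"
    if ij: "i \<in> I" "j \<in> I" "R 0 i = {}" "R 0 j = {}" "x \<in> X i" "y \<in> X j" for i j x y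
  proof (cases "i = j")
    case True
    then show ?thesis using one_layer that by blast
  next
    case False
    then obtain u v where uv: "u \<in> X i" "v \<in> X j" "adj ?G u v"
      using edge ij by blast
    then have "layer u = layer v"
      using ij(3,4) unfolding adj_pasted_graph R_def by auto
    then show ?thesis using one_layer uv that by metis
  qed
  obtain r where r: "r \<noteq> 0" "\<And>j y. j \<in> I \<Longrightarrow> R 0 j = {} \<Longrightarrow> y \<in> X j \<Longrightarrow> layer y = r"
  proof (cases "\<exists>i\<in>I. R 0 i = {}")
    case True
    then obtain i x where i: "i \<in> I" "R 0 i = {}" "x \<in> X i"
      using X by blast
    show thesis
    proof (rule that[of "layer x"])
      show "layer x \<noteq> 0" using i(2,3) unfolding R_def by auto
    qed (use same_layer i in blast)
  next
    case False
    \<comment> \<open>If every branch set meets layer 0, the condition on \<open>r\<close> is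
      vacuous and any nonzero value serves.\<close>
    show thesis by (rule that[of 1]) (use False in auto)
  qed
  show thesis
  proof (rule that[of I "R 0" "R r"])
    show nonempty: "R 0 i \<noteq> {} \<or> R r i \<noteq> {}" if "i \<in> I" for i
    proof (cases "R 0 i = {}")
      case True
      obtain x where "x \<in> X i" using X[OF \<open>i \<in> I\<close>] by blast
      then have "pos x \<in> R r i" using r(2)[OF that True] unfolding R_def by auto
      then show ?thesis by blast
    qed simp
    show "\<exists>a\<in>R 0 i. \<exists>b\<in>R r j. \<not> F a b"
      if ij: "i \<in> I" "j \<in> I" "R r i = {}" "R 0 j = {}" for i j
    proof -
      have "i \<noteq> j" using nonempty ij by blast
      then obtain x y where xy: "x \<in> X i" "y \<in> X j" "adj ?G x y"
        using edge ij by blast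
      have y: "layer y = r" using r(2) ij xy by blast
      \<comment> \<open>The edge from \<open>x\<close> to \<open>y\<close> leaves layer
        \<open>r\<close>, which is not layer 0, so \<open>x\<close> must lie in layer 0 and the pair
        is not in \<open>F\<close>.\<close>
      have "layer x \<noteq> r" using ij(3) xy(1) unfolding R_def by auto
      then have "layer x = 0" "\<not> F (pos x) (pos y)"
        using xy(3) y r(1) unfolding adj_pasted_graph by auto
      then show ?thesis using xy y unfolding R_def by blast
    qed
  qed (use I R_sub R_disj in auto)
qed

section \<open>Spread bipartite graphs\<close>

text \<open>Among any \<open>m\<close> disjoint small sets on one side and any \<open>m\<close> on
  the other, some two are completely joined by \<open>F\<close>, hence have no edge between them in
  the pasted graph.\<close>

definition spread :: "nat \<Rightarrow> nat \<Rightarrow> nat \<Rightarrow> (nat \<Rightarrow> nat \<Rightarrow> bool) \<Rightarrow> bool" where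
  "spread n m k F \<longleftrightarrow> (\<forall>X Y :: nat \<Rightarrow> nat set.
     disjoint_family_on X {..<m} \<longrightarrow> disjoint_family_on Y {..<m} \<longrightarrow>
     (\<forall>i<m. X i \<subseteq> {..<n} \<and> card (X i) \<le> k) \<longrightarrow>
     (\<forall>i<m. Y i \<subseteq> {..<n} \<and> card (Y i) \<le> k) \<longrightarrow>
     (\<exists>i<m. \<exists>j<m. \<forall>a\<in>X i. \<forall>b\<in>Y j. F a b))"

section \<open>Bounding the order of a complete minor by spread\<close>

lemma disjoint_family_card_bound:
  fixes Q :: "'i \<Rightarrow> nat set"
  assumes "finite J" "disjoint_family_on Q J"
    and "\<And>i. i \<in> J \<Longrightarrow> Q i \<subseteq> {..<n}" "\<And>i. i \<in> J \<Longrightarrow> k \<le> card (Q i)"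
  shows "card J * k \<le> n"
proof -
  have "card J * k \<le> (\<Sum>i\<in>J. card (Q i))"
    using sum_mono[of J "\<lambda>_. k" "\<lambda>i. card (Q i)"] assms(4) by simp
  also have "\<dots> = card (\<Union>i\<in>J. Q i)"
    using assms by (intro card_UN_disjoint'[symmetric]) (auto intro: finite_subset)
  also have "\<dots> \<le> card {..<n}"
    using assms(3) by (intro card_mono) auto
  finally show ?thesis by simp
qed

text \<open>Every index is counted by an element of P i, by being among the few small Q i, or by
  k elements of Q i.\<close>

lemma card_index_bound:
  fixes P Q :: "'i \<Rightarrow> nat set"
  assumes "finite I" "disjoint_family_on P I" "disjoint_family_on Q I"
    and sub: "\<And>i. i \<in> I \<Longrightarrow> P i \<subseteq> {..<n}" "\<And>i. i \<in> I \<Longrightarrow> Q i \<subseteq> {..<n}"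
    and small: "card {i \<in> I. P i = {} \<and> card (Q i) \<le> k} \<le> m" and "k > 0"
  shows "card I \<le> n + m + n div k"
proof -
  let ?A = "{i \<in> I. P i \<noteq> {}}" and ?B = "{i \<in> I. P i = {} \<and> card (Q i) \<le> k}"
    and ?C = "{i \<in> I. k \<le> card (Q i)}"
  have fin: "finite (P i)" if "i \<in> I" for i
    using sub(1)[OF that] by (rule finite_subset) simp
  have "card ?A * 1 \<le> n"
  proof (rule disjoint_family_card_bound[of ?A P])
    show "1 \<le> card (P i)" if "i \<in> ?A" for i
      using that fin[of i] by (simp add: Suc_le_eq card_gt_0_iff)
  qed (use assms in \<open>auto simp: disjoint_family_on_def\<close>)
  moreover have "card ?C * k \<le> n"
    using assms by (intro disjoint_family_card_bound[of ?C Q]) (auto simp: disjoint_family_on_def)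
  then have "card ?C \<le> n div k"
    using \<open>k > 0\<close> by (simp add: less_eq_div_iff_mult_less_eq)
  moreover have "card I \<le> card (?A \<union> ?B \<union> ?C)"
    using assms(1) by (intro card_mono) auto
  moreover have "card (?A \<union> ?B \<union> ?C) \<le> card ?A + card ?B + card ?C"
    by (meson add_le_mono1 card_Un_le order_trans)
  ultimately show ?thesis using small by linarith
qed

text \<open>If \<open>I\<close> were larger, \<open>card_index_bound\<close>, used once for each
  order of the two sides, would leave at least \<open>m\<close> indices with \<open>Q i\<close>
  empty and \<open>P i\<close> small, and \<open>m\<close> with \<open>P i\<close> empty and
  \<open>Q i\<close> small. Spread then joins some two of these sets completely in \<open>F\<close>,
  against \<open>cross\<close>.\<close>

lemma spread_index_bound:
  fixes P Q :: "'i \<Rightarrow> nat set"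
  assumes spread: "spread n m k F" and "k > 0" and I: "finite I"
    and P: "disjoint_family_on P I" "\<And>i. i \<in> I \<Longrightarrow> P i \<subseteq> {..<n}"
    and Q: "disjoint_family_on Q I" "\<And>i. i \<in> I \<Longrightarrow> Q i \<subseteq> {..<n}"
    and cross: "\<And>i j. i \<in> I \<Longrightarrow> j \<in> I \<Longrightarrow> Q i = {} \<Longrightarrow> P j = {} \<Longrightarrow> \<exists>a\<in>P i. \<exists>b\<in>Q j. \<not> F a b"
  shows "card I \<le> n + m + n div k"
proof (rule ccontr)
  assume big: "\<not> ?thesis"
  let ?A = "{i \<in> I. Q i = {} \<and> card (P i) \<le> k}" and ?B = "{i \<in> I. P i = {} \<and> card (Q i) \<le> k}"
  have "m \<le> card ?A"
    using card_index_bound[OF I Q(1) P(1) Q(2) P(2), of k m] big \<open>k > 0\<close> by linarith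
  then obtain g where g: "g ` {..<m} \<subseteq> ?A" "inj_on g {..<m}"
    using card_le_inj[of "{..<m}" ?A] I by auto
  have "m \<le> card ?B"
    using card_index_bound[OF I P(1) Q(1) P(2) Q(2), of k m] big \<open>k > 0\<close> by linarith
  then obtain h where h: "h ` {..<m} \<subseteq> ?B" "inj_on h {..<m}"
    using card_le_inj[of "{..<m}" ?B] I by auto
  have gh: "g i \<in> ?A" "h i \<in> ?B" if "i < m" for i
    using g(1) h(1) that by blast+
  have "disjoint_family_on (\<lambda>i. P (g i)) {..<m}"
    unfolding disjoint_family_on_def
    using disjoint_family_onD[OF P(1)] inj_onD[OF g(2)] gh by blast
  moreover have "disjoint_family_on (\<lambda>i. Q (h i)) {..<m}"
    unfolding disjoint_family_on_def
    using disjoint_family_onD[OF Q(1)] inj_onD[OF h(2)] gh by blast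
  moreover have "\<forall>i<m. P (g i) \<subseteq> {..<n} \<and> card (P (g i)) \<le> k"
    using gh P(2) by auto
  moreover have "\<forall>i<m. Q (h i) \<subseteq> {..<n} \<and> card (Q (h i)) \<le> k"
    using gh Q(2) by auto
  ultimately obtain i j where "i < m" "j < m" "\<forall>a\<in>P (g i). \<forall>b\<in>Q (h j). F a b"
    using spread[unfolded spread_def, rule_format, of "\<lambda>i. P (g i)" "\<lambda>i. Q (h i)"] by blast
  then show False
    using cross[of "g i" "h j"] gh[of i] gh[of j] by blast
qed

section \<open>Existence of spread graphs by the union bound\<close>

text \<open>For a uniformly random \<open>f\<close>, agreement with \<open>g\<close> on disjoint
  blocks gives independent events, each of probability at least
  \<open>1 / real (card D) ^ s\<close>. The induction splits off one block at a time and counts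
  functions instead of using probabilities.\<close>

lemma card_PiE_avoiding_blocks:
  fixes g :: "'a \<Rightarrow> 'b" and B :: "'i \<Rightarrow> 'a set"
  assumes "finite I" "finite S" "finite D" "D \<noteq> {}"
    and "disjoint_family_on B I"
    and "\<And>i. i \<in> I \<Longrightarrow> B i \<subseteq> S" "\<And>i. i \<in> I \<Longrightarrow> card (B i) \<le> s"
    and "\<And>x. x \<in> S \<Longrightarrow> g x \<in> D"
  shows "real (card {f \<in> S \<rightarrow>\<^sub>E D. \<forall>i\<in>I. \<exists>x\<in>B i. f x \<noteq> g x})
    \<le> real (card D) ^ card S * (1 - 1 / real (card D) ^ s) ^ card I"
  using assms(1,2,5-)
proof (induction I arbitrary: S rule: finite_induct)
  case empty
  then show ?case by (simp add: card_PiE)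
next
  case (insert i I)
  let ?d = "real (card D)"
  have d: "?d \<ge> 1"
    using assms(3,4) by (simp add: Suc_le_eq card_gt_0_iff)
  have finB: "finite (B i)"
    using insert.prems by (auto intro: finite_subset)
  define U where "U = {f \<in> S \<rightarrow>\<^sub>E D. \<forall>j\<in>insert i I. \<exists>x\<in>B j. f x \<noteq> g x}"
  \<comment> \<open>\<open>V\<close> holds the admissible patterns on the new block, and
    \<open>W\<close> the functions on the rest that avoid agreement on the other blocks.\<close>
  define V where "V = (B i \<rightarrow>\<^sub>E D) - {restrict g (B i)}"
  define W where "W = {f \<in> (S - B i) \<rightarrow>\<^sub>E D. \<forall>j\<in>I. \<exists>x\<in>B j. f x \<noteq> g x}"
  have disj: "B j \<inter> B i = {}" if "j \<in> I" for j
    using disjoint_family_onD[OF insert.prems(2), of j i] insert.hyps(2) that by auto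
  have W: "real (card W) \<le> ?d ^ card (S - B i) * (1 - 1 / ?d ^ s) ^ card I"
    unfolding W_def
  proof (rule insert.IH)
    show "disjoint_family_on B I"
      using insert.prems(2) by (rule disjoint_family_on_mono[rotated]) blast
    show "B j \<subseteq> S - B i" if "j \<in> I" for j
      using insert.prems(3)[of j] disj[OF that] that by blast
  qed (use insert.prems in auto)
  have "restrict g (B i) \<in> B i \<rightarrow>\<^sub>E D"
    using insert.prems by auto
  then have "card V = card D ^ card (B i) - 1"
    unfolding V_def using finB assms(3) by (simp add: card_PiE finite_PiE)
  then have V: "real (card V) = ?d ^ card (B i) * (1 - 1 / ?d ^ card (B i))"
    using d by (simp add: of_nat_diff field_simps)
  have finV: "finite V"
    unfolding V_def using finB assms(3) by (simp add: finite_PiE)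
  have "W \<subseteq> (S - B i) \<rightarrow>\<^sub>E D"
    unfolding W_def by blast
  then have finW: "finite W"
    by (rule finite_subset) (simp add: finite_PiE assms(3) insert.prems(1))
  \<comment> \<open>A function on \<open>S\<close> is determined by its two restrictions, so
    \<open>U\<close> embeds into the product of \<open>V\<close> and \<open>W\<close>.\<close>
  have "inj_on (\<lambda>f. (restrict f (B i), restrict f (S - B i))) U"
  proof (rule inj_onI)
    fix f h assume fh: "f \<in> U" "h \<in> U"
      "(restrict f (B i), restrict f (S - B i)) = (restrict h (B i), restrict h (S - B i))"
    show "f = h"
    proof (rule PiE_ext[of _ S "\<lambda>_. D"])
      show "f x = h x" if "x \<in> S" for x
        using fh(3) that by (cases "x \<in> B i") (auto dest: fun_cong[of _ _ x])
    qed (use fh in \<open>auto simp: U_def\<close>)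
  qed
  moreover have "(\<lambda>f. (restrict f (B i), restrict f (S - B i))) ` U \<subseteq> V \<times> W"
  proof clarify
    fix f assume f: "f \<in> U"
    have "restrict f (B i) \<noteq> restrict g (B i)"
    proof
      assume eq: "restrict f (B i) = restrict g (B i)"
      obtain x where "x \<in> B i" "f x \<noteq> g x"
        using f unfolding U_def by blast
      then show False using fun_cong[OF eq, of x] by simp
    qed
    moreover have "restrict f (B i) \<in> B i \<rightarrow>\<^sub>E D"
      using f insert.prems(3)[of i] unfolding U_def by fastforce
    moreover have "restrict f (S - B i) \<in> W"
    proof -
      have "\<exists>x\<in>B j. restrict f (S - B i) x \<noteq> g x" if "j \<in> I" for j
      proof -
        obtain x where "x \<in> B j" "f x \<noteq> g x"
          using f \<open>j \<in> I\<close> unfolding U_def by blast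
        moreover have "x \<in> S - B i"
          using \<open>x \<in> B j\<close> insert.prems(3)[of j] disj[OF that] that by blast
        ultimately show ?thesis by auto
      qed
      moreover have "restrict f (S - B i) \<in> (S - B i) \<rightarrow>\<^sub>E D"
        using f unfolding U_def by fastforce
      ultimately show ?thesis unfolding W_def by blast
    qed
    ultimately show "restrict f (B i) \<in> V \<and> restrict f (S - B i) \<in> W"
      unfolding V_def by blast
  qed
  ultimately have "card U \<le> card (V \<times> W)"
    using finV finW by (intro card_inj_on_le) auto
  then have "real (card U) \<le> real (card V) * real (card W)"
    by (metis card_cartesian_product of_nat_le_iff of_nat_mult)
  also have "\<dots> \<le> (?d ^ card (B i) * (1 - 1 / ?d ^ s)) *
      (?d ^ card (S - B i) * (1 - 1 / ?d ^ s) ^ card I)"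
  proof (rule mult_mono)
    \<comment> \<open>A block with fewer than \<open>s\<close> elements only makes agreement
      likelier, so the bound for size \<open>s\<close> still holds.\<close>
    have "?d ^ card (B i) \<le> ?d ^ s"
      using d insert.prems(4)[of i] by (intro power_increasing) auto
    then have "1 / ?d ^ s \<le> 1 / ?d ^ card (B i)"
      using d by (intro divide_left_mono) auto
    then show "real (card V) \<le> ?d ^ card (B i) * (1 - 1 / ?d ^ s)"
      unfolding V using d by (intro mult_left_mono) auto
    show "0 \<le> ?d ^ card (B i) * (1 - 1 / ?d ^ s)"
      using d by (simp add: field_simps)
  qed (use W in auto)
  also have "\<dots> = ?d ^ (card (B i) + card (S - B i)) * (1 - 1 / ?d ^ s) ^ card (insert i I)"
    using insert.hyps by (simp add: power_add)
  also have "card (B i) + card (S - B i) = card S"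
    using insert.prems(1) insert.prems(3)[of i] finB
    by (simp add: card_Diff_subset card_mono)
  finally show ?case unfolding U_def .
qed

text \<open>Averaging: the \<open>d\<close> fibres partition \<open>{..<n}\<close>. Applied to each
  \<open>b\<close>, this later keeps the degrees in \<open>F\<close> at most
  \<open>n / d\<close>.\<close>

lemma exists_rare_value:
  fixes f :: "nat \<Rightarrow> nat"
  assumes "\<And>a. a < n \<Longrightarrow> f a < d" "d > 0"
  shows "\<exists>c<d. d * card {a. a < n \<and> f a = c} \<le> n"
proof (rule ccontr)
  assume "\<not> ?thesis"
  then have "(\<Sum>c<d. n) < (\<Sum>c<d. d * card {a. a < n \<and> f a = c})"
    using assms(2) by (intro sum_strict_mono) (auto simp: not_le)
  also have "\<dots> = d * card (\<Union>c<d. {a. a < n \<and> f a = c})"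
    by (subst card_UN_disjoint) (auto simp: sum_distrib_left)
  also have "(\<Union>c<d. {a. a < n \<and> f a = c}) = {..<n}"
    using assms(1) by auto
  finally show False by simp
qed

text \<open>Disjoint families are coded by functions into \<open>{..m}\<close>, with the extra label
  \<open>m\<close> for elements in no member. Hence at most \<open>(m + 1) ^ n\<close> codes enter
  the union bound.\<close>

lemma disjoint_family_labelling:
  fixes X :: "nat \<Rightarrow> nat set"
  assumes "disjoint_family_on X {..<m}" "\<And>i. i < m \<Longrightarrow> X i \<subseteq> {..<n}"
  obtains x where "x \<in> {..<n} \<rightarrow>\<^sub>E {..m}" "\<And>i. i < m \<Longrightarrow> {a. a < n \<and> x a = i} = X i"
proof
  define x where "x = (\<lambda>a\<in>{..<n}. if \<exists>i<m. a \<in> X i then SOME i. i < m \<and> a \<in> X i else m)"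
  have x: "x a = i" if "i < m" "a \<in> X i" for a i
  proof -
    have "a < n" using that assms(2) by blast
    have "(SOME i. i < m \<and> a \<in> X i) = i"
    proof (rule some_equality)
      show "j = i" if "j < m \<and> a \<in> X j" for j
        using disjoint_family_onD[OF assms(1), of i j] that \<open>i < m\<close> \<open>a \<in> X i\<close> by auto
    qed (use that in blast)
    then show ?thesis
      unfolding x_def using that \<open>a < n\<close> by auto
  qed
  have x': "x a = m" if "a < n" "\<not> (\<exists>i<m. a \<in> X i)" for a
    unfolding x_def using that by auto
  show "x \<in> {..<n} \<rightarrow>\<^sub>E {..m}"
  proof (rule PiE_I)
    show "x a \<in> {..m}" if "a \<in> {..<n}" for a
      using x x' that by (cases "\<exists>i<m. a \<in> X i") auto
  qed (auto simp: x_def)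
  show "{a. a < n \<and> x a = i} = X i" if "i < m" for i
  proof (intro set_eqI iffI)
    fix a assume "a \<in> {a. a < n \<and> x a = i}"
    then have "a < n" "x a = i" by auto
    then obtain j where "j < m" "a \<in> X j"
      using x' \<open>i < m\<close> by fastforce
    then show "a \<in> X i" using x \<open>x a = i\<close> by blast
  qed (use x assms(2) that in blast)
qed

text \<open>Colour the pairs (a, b) with d colours at random. For fixed labellings x, y of the two
  sides and a fixed choice c of one colour per b, the events that all pairs (a, b) with x a = i and
  y b = j have colour c b are independent for different (i, j).\<close>

lemma exists_spread:
  fixes n m k d :: nat
  assumes "d > 0"
    and small: "real (m + 1) ^ (2 * n) * real d ^ n * (1 - 1 / real d ^ (k * k)) ^ (m * m) < 1"
  shows "\<exists>F. (\<forall>b<n. d * card {a. a < n \<and> F a b} \<le> n) \<and> spread n m k F"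
proof -
  let ?S = "{..<n} \<times> {..<n}"
  define \<Omega> where "\<Omega> = ?S \<rightarrow>\<^sub>E {..<d}"
  define cls where "cls x i = {a. a < n \<and> x a = i}" for x :: "nat \<Rightarrow> nat" and i :: nat
  define lab where "lab = {x \<in> {..<n} \<rightarrow>\<^sub>E {..m}. \<forall>i<m. card (cls x i) \<le> k}"
  \<comment> \<open>\<open>bad (x, y, c)\<close> collects the colourings \<open>f\<close> for which
    the graph with edges where \<open>f (a, b) = c b\<close> joins no two of the sets coded by
    \<open>x\<close> and \<open>y\<close>.\<close>
  define bad where "bad = (\<lambda>(x, y, c :: nat \<Rightarrow> nat).
    {f \<in> \<Omega>. \<forall>p\<in>{..<m} \<times> {..<m}. \<exists>z\<in>cls x (fst p) \<times> cls y (snd p). f z \<noteq> c (snd z)})"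
  \<comment> \<open>All choices \<open>c\<close> enter the union bound because the one finally used
    depends on \<open>f\<close>.\<close>
  define Idx where "Idx = lab \<times> lab \<times> ({..<n} \<rightarrow>\<^sub>E {..<d})"
  let ?\<beta> = "(1 - 1 / real d ^ (k * k)) ^ (m * m)"
  have \<beta>: "?\<beta> \<ge> 0"
    using \<open>d > 0\<close> by (intro zero_le_power) (simp add: field_simps Suc_le_eq)
  have bad: "real (card (bad w)) \<le> real d ^ (n * n) * ?\<beta>" if "w \<in> Idx" for w
  proof -
    obtain x y c where w: "w = (x, y, c)" by (cases w)
    have xyc: "x \<in> lab" "y \<in> lab" "c \<in> {..<n} \<rightarrow>\<^sub>E {..<d}"
      using that unfolding w Idx_def by auto
    have "real (card {f \<in> ?S \<rightarrow>\<^sub>E {..<d}.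
        \<forall>p\<in>{..<m} \<times> {..<m}. \<exists>z\<in>cls x (fst p) \<times> cls y (snd p). f z \<noteq> (c \<circ> snd) z})
      \<le> real (card {..<d}) ^ card ?S *
        (1 - 1 / real (card {..<d}) ^ (k * k)) ^ card ({..<m} \<times> {..<m})"
    proof (rule card_PiE_avoiding_blocks)
      show "disjoint_family_on (\<lambda>p. cls x (fst p) \<times> cls y (snd p)) ({..<m} \<times> {..<m})"
        unfolding disjoint_family_on_def cls_def by auto
      show "card (cls x (fst p) \<times> cls y (snd p)) \<le> k * k" if "p \<in> {..<m} \<times> {..<m}" for p
        using xyc that unfolding card_cartesian_product lab_def by (intro mult_le_mono) auto
      show "cls x (fst p) \<times> cls y (snd p) \<subseteq> ?S" for p
        unfolding cls_def by auto
      show "(c \<circ> snd) z \<in> {..<d}" if "z \<in> ?S" for z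
        using xyc(3) that by (auto simp: PiE_iff)
    qed (use \<open>d > 0\<close> in auto)
    then show ?thesis
      unfolding w bad_def \<Omega>_def by (simp add: card_cartesian_product)
  qed
  have lab: "finite lab" "card lab \<le> (m + 1) ^ n"
  proof -
    have "finite ({..<n} \<rightarrow>\<^sub>E {..m})" "lab \<subseteq> {..<n} \<rightarrow>\<^sub>E {..m}"
      unfolding lab_def by (auto intro: finite_PiE)
    then show "finite lab" "card lab \<le> (m + 1) ^ n"
      using card_mono[of "{..<n} \<rightarrow>\<^sub>E {..m}" lab] by (auto simp: card_PiE intro: finite_subset)
  qed
  have finIdx: "finite Idx"
    unfolding Idx_def using lab(1) by (auto intro!: finite_PiE)
  have "card Idx = card lab * card lab * d ^ n"
    unfolding Idx_def by (simp add: card_cartesian_product card_PiE)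
  also have "\<dots> \<le> (m + 1) ^ n * (m + 1) ^ n * d ^ n"
    using lab(2) by (intro mult_le_mono) auto
  also have "\<dots> = (m + 1) ^ (2 * n) * d ^ n"
    by (simp add: mult_2 power_add)
  finally have cardIdx: "real (card Idx) \<le> real (m + 1) ^ (2 * n) * real d ^ n"
    by (metis of_nat_le_iff of_nat_mult of_nat_power)
  have fin\<Omega>: "finite \<Omega>" and card\<Omega>: "card \<Omega> = d ^ (n * n)"
    unfolding \<Omega>_def by (auto intro!: finite_PiE simp: card_PiE card_cartesian_product)
  have "real (card (\<Union>w\<in>Idx. bad w)) \<le> (\<Sum>w\<in>Idx. real (card (bad w)))"
    using card_UN_le[OF finIdx, of bad] by (metis of_nat_le_iff of_nat_sum)
  also have "\<dots> \<le> real (card Idx) * (real d ^ (n * n) * ?\<beta>)"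
    using sum_bounded_above[of Idx "\<lambda>w. real (card (bad w))"] bad by blast
  also have "\<dots> \<le> (real (m + 1) ^ (2 * n) * real d ^ n) * (real d ^ (n * n) * ?\<beta>)"
    using cardIdx \<beta> by (intro mult_right_mono) auto
  also have "\<dots> = real d ^ (n * n) * (real (m + 1) ^ (2 * n) * real d ^ n * ?\<beta>)"
    by (simp only: mult_ac)
  also have "\<dots> < real d ^ (n * n) * 1"
    using small \<open>d > 0\<close> by (intro mult_strict_left_mono) auto
  finally have "card (\<Union>w\<in>Idx. bad w) < card \<Omega>"
    unfolding card\<Omega> by (simp flip: of_nat_power)
  moreover have "finite (\<Union>w\<in>Idx. bad w)"
    by (rule finite_subset[OF _ fin\<Omega>]) (auto simp: bad_def)
  ultimately have "\<not> \<Omega> \<subseteq> (\<Union>w\<in>Idx. bad w)"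
    using card_mono[of "\<Union>w\<in>Idx. bad w" \<Omega>] by linarith
  then obtain f where f: "f \<in> \<Omega>" "\<And>w. w \<in> Idx \<Longrightarrow> f \<notin> bad w"
    by blast
  \<comment> \<open>Only now is \<open>c\<close> fixed: for each \<open>b\<close> a colour that is
    rare among the pairs with second entry \<open>b\<close>, which makes \<open>F\<close>
    sparse.\<close>
  have "\<exists>c<d. d * card {a. a < n \<and> f (a, b) = c} \<le> n" if "b < n" for b
    using f(1) that \<open>d > 0\<close> unfolding \<Omega>_def
    by (intro exists_rare_value) (auto simp: PiE_iff)
  then obtain c0 where c0: "\<And>b. b < n \<Longrightarrow> c0 b < d \<and> d * card {a. a < n \<and> f (a, b) = c0 b} \<le> n"
    by metis
  define c where "c = restrict c0 {..<n}"
  have c: "c \<in> {..<n} \<rightarrow>\<^sub>E {..<d}"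
    "\<And>b. b < n \<Longrightarrow> d * card {a. a < n \<and> f (a, b) = c b} \<le> n"
    using c0 unfolding c_def by auto
  have "spread n m k (\<lambda>a b. f (a, b) = c b)"
    unfolding spread_def
  proof (intro allI impI)
    fix X Y :: "nat \<Rightarrow> nat set"
    assume X: "disjoint_family_on X {..<m}" "\<forall>i<m. X i \<subseteq> {..<n} \<and> card (X i) \<le> k"
      and Y: "disjoint_family_on Y {..<m}" "\<forall>i<m. Y i \<subseteq> {..<n} \<and> card (Y i) \<le> k"
    obtain x where x: "x \<in> {..<n} \<rightarrow>\<^sub>E {..m}" "\<And>i. i < m \<Longrightarrow> cls x i = X i"
      using disjoint_family_labelling[OF X(1), of n] X(2) unfolding cls_def by blast
    obtain y where y: "y \<in> {..<n} \<rightarrow>\<^sub>E {..m}" "\<And>i. i < m \<Longrightarrow> cls y i = Y i"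
      using disjoint_family_labelling[OF Y(1), of n] Y(2) unfolding cls_def by blast
    have "x \<in> lab" "y \<in> lab"
      unfolding lab_def using x y X(2) Y(2) by auto
    then have "f \<notin> bad (x, y, c)"
      using f(2) c(1) unfolding Idx_def by blast
    then obtain i j where "i < m" "j < m" "\<forall>z\<in>cls x i \<times> cls y j. f z = c (snd z)"
      using f(1) unfolding bad_def by auto
    then show "\<exists>i<m. \<exists>j<m. \<forall>a\<in>X i. \<forall>b\<in>Y j. f (a, b) = c b"
      using x(2) y(2) by fastforce
  qed
  then show ?thesis
    using c(2) by (intro exI[of _ "\<lambda>a b. f (a, b) = c b"]) auto
qed

text \<open>The logarithms of the first two factors grow like \<open>n * ln n\<close> and
  \<open>n\<close>, while that of the third is at most a negative constant times the square of
  \<open>n\<close>.\<close>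

lemma union_bound_eventually_small:
  fixes \<gamma> :: real and d k :: nat
  assumes "\<gamma> > 0" "d > 0"
  shows "\<forall>\<^sub>F n in sequentially. real (nat \<lceil>\<gamma> * real n\<rceil> + 1) ^ (2 * n) * real d ^ n *
    (1 - 1 / real d ^ (k * k)) ^ (nat \<lceil>\<gamma> * real n\<rceil> * nat \<lceil>\<gamma> * real n\<rceil>) < 1"
proof -
  define \<beta> where "\<beta> = 1 / real d ^ (k * k)"
  define L where "L = ln (real d)"
  have \<beta>: "\<beta> > 0" "\<beta> \<le> 1"
    unfolding \<beta>_def using assms(2) by (auto simp: field_simps Suc_le_eq)
  have pos: "\<beta> * \<gamma>\<^sup>2 > 0" using \<beta> assms by simp
  \<comment> \<open>The \<open>+ 2\<close> covers both the rounding in the ceiling and the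
    \<open>+ 1\<close> in the base.\<close>
  have "\<forall>\<^sub>F n in sequentially.
      2 * real n * ln (\<gamma> * real n + 2) + real n * L - \<beta> * \<gamma>\<^sup>2 * (real n)\<^sup>2 < 0"
    using assms(1) pos by real_asymp
  then show ?thesis
  proof eventually_elim
    case (elim n)
    let ?m = "nat \<lceil>\<gamma> * real n\<rceil>"
    have m: "\<gamma> * real n \<le> real ?m" "real ?m \<le> \<gamma> * real n + 1"
      using assms(1) by (auto intro: real_nat_ceiling_ge simp: of_nat_ceiling)
    have "0 \<le> \<gamma> * real n" using assms(1) by simp
    have "real (?m + 1) ^ (2 * n) \<le> (\<gamma> * real n + 2) ^ (2 * n)"
      using m by (intro power_mono) auto
    also have "\<dots> = exp (2 * real n * ln (\<gamma> * real n + 2))"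
      using \<open>0 \<le> \<gamma> * real n\<close> exp_of_nat_mult[of "2 * n" "ln (\<gamma> * real n + 2)"] by simp
    finally have 1: "real (?m + 1) ^ (2 * n) \<le> exp (2 * real n * ln (\<gamma> * real n + 2))" .
    have 2: "real d ^ n = exp (real n * L)"
      unfolding L_def using assms(2) by (simp add: exp_of_nat_mult)
    have "(1 - \<beta>) ^ (?m * ?m) \<le> exp (- \<beta>) ^ (?m * ?m)"
      using exp_ge_add_one_self[of "- \<beta>"] \<beta> by (intro power_mono) auto
    also have "\<dots> = exp (- (\<beta> * (real ?m * real ?m)))"
      by (simp flip: exp_of_nat_mult add: mult_ac)
    also have "\<dots> \<le> exp (- (\<beta> * \<gamma>\<^sup>2 * (real n)\<^sup>2))"
      using mult_mono[OF m(1) m(1)] \<beta> \<open>0 \<le> \<gamma> * real n\<close>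
      by (simp add: power2_eq_square mult_ac mult_left_mono)
    finally have 3: "(1 - \<beta>) ^ (?m * ?m) \<le> exp (- (\<beta> * \<gamma>\<^sup>2 * (real n)\<^sup>2))" .
    have "real (?m + 1) ^ (2 * n) * real d ^ n * (1 - \<beta>) ^ (?m * ?m)
      \<le> exp (2 * real n * ln (\<gamma> * real n + 2)) * exp (real n * L)
        * exp (- (\<beta> * \<gamma>\<^sup>2 * (real n)\<^sup>2))"
      using 1 2 3 \<beta> by (intro mult_mono) auto
    also have "\<dots> = exp (2 * real n * ln (\<gamma> * real n + 2) + real n * L - \<beta> * \<gamma>\<^sup>2 * (real n)\<^sup>2)"
      by (simp add: exp_add exp_diff exp_minus field_simps)
    also have "\<dots> < 1"
      using elim by simp
    finally show ?case unfolding \<beta>_def .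
  qed
qed

section \<open>Bad list assignments\<close>

lemma UN_consecutive_intervals:
  fixes p :: "nat \<Rightarrow> nat"
  assumes "mono p" "p 0 = 0"
  shows "(\<Union>i<q. {p i..<p (Suc i)}) = {..<p q}"
proof (induction q)
  case (Suc q)
  have "p q \<le> p (Suc q)" using assms(1) by (simp add: monoD)
  then show ?case
    using Suc by (auto simp: lessThan_Suc)
qed (simp add: assms(2))

lemma disjoint_consecutive_intervals:
  fixes p :: "nat \<Rightarrow> nat"
  assumes "mono p" "i \<noteq> j"
  shows "{p i..<p (Suc i)} \<inter> {p j..<p (Suc j)} = {}"
proof (cases "i < j")
  case True
  then have "p (Suc i) \<le> p j" using assms(1) by (simp add: monoD)
  then show ?thesis by auto
next
  case False
  then have "p (Suc j) \<le> p i" using assms by (simp add: monoD)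
  then show ?thesis by auto
qed

text \<open>Each colouring c of layer 0 gets its own layer; there the list of the b-th vertex omits the
  colours of its non-neighbours under c, so extending c needs 2 n distinct colours.\<close>

lemma pasted_graph_not_choosable:
  assumes "n > 0" and deg: "\<And>b. b < n \<Longrightarrow> card {a. a < n \<and> F a b} \<le> s"
    and few: "sum_list ks + length ks * s < 2 * n"
  shows "\<exists>M. \<not> lambda_choosable ks (pasted_graph M n F)"
proof -
  \<comment> \<open>The palette has \<open>s\<close> spare colours in each part, so removing at most
    \<open>s\<close> colours leaves at least \<open>ks ! i\<close> in part \<open>i\<close>.\<close>
  define N where "N = sum_list ks + length ks * s"
  define cols where "cols = {..<n} \<rightarrow>\<^sub>E {..<N}"
  define M where "M = card cols"
  have "finite cols" unfolding cols_def by (auto intro: finite_PiE)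
  then obtain e where e: "bij_betw e {0..<M} cols"
    unfolding M_def using ex_bij_betw_nat_finite by blast
  let ?G = "pasted_graph M n F"
  \<comment> \<open>Layer \<open>Suc r\<close> belongs to the colouring \<open>e r\<close>, hence
    the shift by 1. Layer 0 keeps the whole palette.\<close>
  define L where "L v = (if layer v = 0 then {..<N}
    else {..<N} - e (layer v - 1) ` {a. a < n \<and> F a (pos v)})" for v
  define p where "p i = (\<Sum>j<i. ks ! j + s)" for i
  define C where "C i = {p i..<p (Suc i)}" for i
  have p: "mono p" "p 0 = 0"
    unfolding p_def by (auto intro!: monoI sum_mono2)
  have pN: "p (length ks) = N"
    unfolding p_def N_def by (simp add: sum.distrib sum_list_sum_nth atLeast0LessThan)
  have UN_C: "(\<Union>i<length ks. C i) = {..<N}"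
    unfolding C_def UN_consecutive_intervals[OF p] pN ..
  have L_sub: "L v \<subseteq> {..<N}" for v
    unfolding L_def by auto
  have UN_L: "(\<Union>v\<in>verts ?G. L v) = {..<N}"
  proof
    have "prod_encode (0, 0) \<in> verts ?G" "L (prod_encode (0, 0)) = {..<N}"
      using \<open>n > 0\<close> unfolding verts_pasted_graph L_def by auto
    then show "{..<N} \<subseteq> (\<Union>v\<in>verts ?G. L v)" by blast
  qed (use L_sub in blast)
  have card_L: "ks ! i \<le> card (L v \<inter> C i)" if v: "v \<in> verts ?G" and i: "i < length ks" for v i
  proof -
    let ?R = "e (layer v - 1) ` {a. a < n \<and> F a (pos v)}"
    have "card ?R \<le> card {a. a < n \<and> F a (pos v)}"
      by (intro card_image_le) auto
    also have "\<dots> \<le> s"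
      using v unfolding verts_pasted_graph by (intro deg) auto
    finally have "card ?R \<le> s" .
    moreover have "card (C i) = ks ! i + s"
      unfolding C_def p_def by simp
    moreover have "card (C i) - card ?R \<le> card (C i - ?R)"
      by (intro diff_card_le_card_Diff) auto
    ultimately have "ks ! i \<le> card (C i - ?R)" by linarith
    also have "\<dots> \<le> card (L v \<inter> C i)"
      using UN_C i by (intro card_mono) (auto simp: L_def C_def)
    finally show ?thesis .
  qed
  have "lambda_list_assignment ks ?G L"
    unfolding lambda_list_assignment_def
  proof (intro conjI exI[of _ C])
    show "\<forall>v\<in>verts ?G. finite (L v)"
      using L_sub finite_subset by blast
    show "\<forall>i<length ks. \<forall>j<length ks. i \<noteq> j \<longrightarrow> C i \<inter> C j = {}"
      unfolding C_def using disjoint_consecutive_intervals[OF p(1)] by blast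
  qed (use UN_C UN_L card_L in auto)
  moreover have "\<not> L_colourable ?G L"
  proof
    assume "L_colourable ?G L"
    then obtain f where f: "\<And>v. v \<in> verts ?G \<Longrightarrow> f v \<in> L v"
      "\<And>u v. adj ?G u v \<Longrightarrow> f u \<noteq> f v"
      unfolding L_colourable_def by blast
    define c where "c = (\<lambda>a\<in>{..<n}. f (prod_encode (0, a)))"
    have "f (prod_encode (0, a)) \<in> {..<N}" if "a < n" for a
      using f(1)[of "prod_encode (0, a)"] L_sub that by (auto simp: verts_pasted_graph)
    then have "c \<in> cols"
      unfolding cols_def c_def by auto
    \<comment> \<open>Layer \<open>Suc r\<close> was built against exactly the colouring that
      \<open>f\<close> induces on layer 0.\<close>
    then obtain r where r: "r < M" "e r = c"
      using e unfolding bij_betw_def by (metis atLeastLessThan_iff imageE)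
    let ?W = "prod_encode ` ({0, Suc r} \<times> {..<n})"
    have W: "?W \<subseteq> verts ?G"
      using r(1) by (auto simp: verts_pasted_graph)
    \<comment> \<open>A pair in \<open>F\<close> is not adjacent, but the list of the second vertex
      omits the colour \<open>c a\<close> of the first. Any other pair is an edge.\<close>
    have cross: "f (prod_encode (0, a)) \<noteq> f (prod_encode (Suc r, b))" if "a < n" "b < n" for a b
    proof (cases "F a b")
      case True
      have "f (prod_encode (Suc r, b)) \<in> L (prod_encode (Suc r, b))"
        using f(1) r(1) that by (auto simp: verts_pasted_graph)
      then have "f (prod_encode (Suc r, b)) \<noteq> c a"
        using True that(1) r(2) unfolding L_def by auto
      then show ?thesis unfolding c_def using that by auto
    next
      case False
      then show ?thesis
        using r(1) that by (intro f(2)) (auto simp: adj_pasted_graph)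
    qed
    have "inj_on f ?W"
    proof (rule inj_onI, rule ccontr)
      fix u v assume uv: "u \<in> ?W" "v \<in> ?W" "f u = f v" "u \<noteq> v"
      then have "layer u \<noteq> layer v"
        using f(2)[of u v] W by (auto simp: adj_pasted_graph verts_pasted_graph)
      then show False
        using uv cross by (auto; metis)
    qed
    moreover have "f ` ?W \<subseteq> {..<N}"
      using W f(1) L_sub by blast
    ultimately have "card ?W \<le> N"
      using card_inj_on_le[of f ?W "{..<N}"] by simp
    moreover have "card ?W = 2 * n"
      by (subst card_image) (auto simp: inj_prod_encode card_cartesian_product)
    ultimately show False using few unfolding N_def by linarith
  qed
  ultimately show ?thesis unfolding lambda_choosable_def by blast
qed

section \<open>Choice of parameters\<close>

theorem theorem4:
  shows "\<forall>\<epsilon>::real. 0 < \<epsilon> \<and> \<epsilon> < 1 \<longrightarrow> (\<forall>q::nat. q \<ge> 1 \<longrightarrow>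
    (\<exists>t3::nat. \<forall>t::nat. t \<ge> t3 \<longrightarrow>
      (\<forall>ks::nat list. length ks = q \<and> (\<forall>k\<in>set ks. k \<ge> 1) \<and>
          real (sum_list ks) \<le> (2 - \<epsilon>) * real t \<longrightarrow>
        (\<exists>G. simple_graph G \<and> \<not> has_K_minor t G \<and> \<not> lambda_choosable ks G))))"
proof (intro allI impI)
  fix \<epsilon> :: real and q :: nat
  assume \<epsilon>: "0 < \<epsilon> \<and> \<epsilon> < 1" and q: "1 \<le> q"
  \<comment> \<open>With \<open>d\<close> the \<open>q\<close> parts need at most
    \<open>\<epsilon> * n / 8\<close> spare colours in total. With \<open>k\<close> and
    \<open>m\<close> the minor bound exceeds \<open>n\<close> by at most
    \<open>\<epsilon> * n / 8 + 1\<close>.\<close>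
  define d where "d = nat \<lceil>8 * real q / \<epsilon>\<rceil>"
  define k where "k = nat \<lceil>16 / \<epsilon>\<rceil>"
  have d: "8 * real q / \<epsilon> \<le> real d" and k: "16 / \<epsilon> \<le> real k"
    unfolding d_def k_def by (rule real_nat_ceiling_ge)+
  have "0 < 8 * real q / \<epsilon>" "0 < 16 / \<epsilon>" using \<epsilon> q by auto
  then have dk: "d > 0" "k > 0" using d k by (auto intro: gr0I)
  define m where "m n = nat \<lceil>\<epsilon> / 16 * real n\<rceil>" for n
  obtain n0 where n0: "\<And>n. n \<ge> n0 \<Longrightarrow>
      real (m n + 1) ^ (2 * n) * real d ^ n * (1 - 1 / real d ^ (k * k)) ^ (m n * m n) < 1"
    using union_bound_eventually_small[of "\<epsilon> / 16" d k] \<epsilon> dk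
    unfolding eventually_sequentially m_def by auto
  \<comment> \<open>The first bound forces \<open>n\<close> above \<open>n0\<close>. The second
    gives \<open>64 \<le> \<epsilon> * t\<close>, which absorbs all rounding errors.\<close>
  define t3 where "t3 = max (2 * (n0 + 2)) (nat \<lceil>64 / \<epsilon>\<rceil>)"
  show "\<exists>t3. \<forall>t\<ge>t3. \<forall>ks. length ks = q \<and> (\<forall>k\<in>set ks. 1 \<le> k) \<and>
      real (sum_list ks) \<le> (2 - \<epsilon>) * real t \<longrightarrow>
      (\<exists>G. simple_graph G \<and> \<not> has_K_minor t G \<and> \<not> lambda_choosable ks G)"
  proof (intro exI[of _ t3] allI impI)
    fix t ks
    assume t: "t3 \<le> t" and ks: "length ks = q \<and> (\<forall>k\<in>set ks. 1 \<le> k) \<and>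
      real (sum_list ks) \<le> (2 - \<epsilon>) * real t"
    have "2 * (n0 + 2) \<le> t" "nat \<lceil>64 / \<epsilon>\<rceil> \<le> t"
      using t unfolding t3_def by auto
    then have "real (2 * (n0 + 2)) \<le> real t" "real (nat \<lceil>64 / \<epsilon>\<rceil>) \<le> real t"
      by (simp_all only: of_nat_le_iff)
    then have t_n0: "2 * (real n0 + 2) \<le> real t" and "64 / \<epsilon> \<le> real t"
      using real_nat_ceiling_ge[of "64 / \<epsilon>"] by auto
    then have \<epsilon>t: "64 \<le> \<epsilon> * real t"
      using \<epsilon> by (simp add: field_simps)
    \<comment> \<open>The factor \<open>1 - \<epsilon> / 4\<close> balances two demands.
      \<open>2 * n\<close> exceeds \<open>(2 - \<epsilon>) * t\<close> by more than
      \<open>\<epsilon> * t / 2 - 2\<close>, enough for the spare colours, and \<open>n\<close>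
      stays \<open>\<epsilon> * t / 4\<close> below \<open>t\<close>, enough for the excess in the
      minor bound.\<close>
    define n where "n = nat \<lfloor>(1 - \<epsilon> / 4) * real t\<rfloor>"
    have "\<epsilon> * real t \<le> real t" using \<epsilon> by (simp add: mult_left_le_one_le)
    have n: "real n \<le> real t - \<epsilon> * real t / 4" "real t - \<epsilon> * real t / 4 - 1 < real n"
    proof -
      have "0 \<le> (1 - \<epsilon> / 4) * real t" using \<epsilon> by simp
      then have "real n = of_int \<lfloor>(1 - \<epsilon> / 4) * real t\<rfloor>" unfolding n_def by simp
      moreover have "(1 - \<epsilon> / 4) * real t = real t - \<epsilon> * real t / 4" by (simp add: algebra_simps)
      ultimately show "real n \<le> real t - \<epsilon> * real t / 4" "real t - \<epsilon> * real t / 4 - 1 < real n"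
        by linarith+
    qed
    have "real n0 + 1 < real n"
      using n(2) t_n0 \<open>\<epsilon> * real t \<le> real t\<close> of_nat_0_le_iff[of n0, where 'a = real] by argo
    then have "n \<ge> n0" "n > 0"
      by linarith+
    obtain F where F: "\<And>b. b < n \<Longrightarrow> d * card {a. a < n \<and> F a b} \<le> n" "spread n (m n) k F"
      using exists_spread[OF dk(1) n0[OF \<open>n \<ge> n0\<close>]] by blast
    have \<epsilon>n: "\<epsilon> * real n \<le> \<epsilon> * real t"
      using n(1) \<epsilon> \<epsilon>t by (intro mult_left_mono) auto
    have "real q * real (n div d) \<le> \<epsilon> * real n / 8"
    proof -
      have "real (n div d) \<le> real n / real d" by (rule of_nat_div_le_of_nat)
      also have "\<dots> \<le> real n / (8 * real q / \<epsilon>)"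
        using d dk q \<epsilon> by (intro divide_left_mono) auto
      finally show ?thesis using q \<epsilon> by (simp add: field_simps)
    qed
    then have "real (sum_list ks) + real q * real (n div d) < 2 * real n"
      using ks n(2) \<epsilon>n \<epsilon>t by (simp add: algebra_simps)
    then have "real (sum_list ks + length ks * (n div d)) < real (2 * n)"
      using ks by simp
    then have few: "sum_list ks + length ks * (n div d) < 2 * n"
      by (simp only: of_nat_less_iff)
    have "card {a. a < n \<and> F a b} \<le> n div d" if "b < n" for b
      using F(1)[OF that] dk(1) by (simp add: less_eq_div_iff_mult_less_eq mult.commute)
    then obtain M where M: "\<not> lambda_choosable ks (pasted_graph M n F)"
      using pasted_graph_not_choosable[OF \<open>n > 0\<close> _ few] by blast
    have "real (n div k) \<le> \<epsilon> * real n / 16"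
    proof -
      have "real (n div k) \<le> real n / real k" by (rule of_nat_div_le_of_nat)
      also have "\<dots> \<le> real n / (16 / \<epsilon>)"
        using k dk \<epsilon> by (intro divide_left_mono) auto
      finally show ?thesis by (simp add: mult.commute)
    qed
    moreover have "real (m n) \<le> \<epsilon> * real n / 16 + 1"
      unfolding m_def using \<epsilon> by (simp add: of_nat_ceiling)
    ultimately have "real n + real (m n) + real (n div k) < real t"
      using n(1) \<epsilon>n \<epsilon>t by argo
    then have bound: "n + m n + n div k < t"
      by (simp only: flip: of_nat_add of_nat_less_iff[where 'a = real])
    have "\<not> has_K_minor t (pasted_graph M n F)"
    proof
      assume "has_K_minor t (pasted_graph M n F)"
      then show False
      proof (rule pasted_graph_minor)
        fix I :: "nat set" and P Q
        assume IPQ: "finite I" "disjoint_family_on P I" "\<And>i. i \<in> I \<Longrightarrow> P i \<subseteq> {..<n}"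
          "disjoint_family_on Q I" "\<And>i. i \<in> I \<Longrightarrow> Q i \<subseteq> {..<n}"
          "\<And>i j. i \<in> I \<Longrightarrow> j \<in> I \<Longrightarrow> Q i = {} \<Longrightarrow> P j = {} \<Longrightarrow> \<exists>a\<in>P i. \<exists>b\<in>Q j. \<not> F a b"
          and "card I = t"
        then show False
          using spread_index_bound[OF F(2) dk(2) IPQ] bound by linarith
      qed
    qed
    then show "\<exists>G. simple_graph G \<and> \<not> has_K_minor t G \<and> \<not> lambda_choosable ks G"
      using M simple_graph_pasted_graph by blast
  qed
qed

end
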